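(* If $A=(A_{ij})$ is an $n\times n$ block positive definite matrix with each block $A_{ij}$ square, then for any derangement $\tau\in D_n$, $$\det A+\prod_{i=1}^{n}|\det A_{i,\tau(i)}|\le \prod_{i=1}^{n}\det A_{ii}.$$ Equality holds if and only if $A$ is block diagonal.
   Context: $D_n$ denotes the set of derangements of $\{1,\dots,n\}$, that is, the permutations of $\{1,\dots,n\}$ with no fixed point. Positive definite matrices are complex Hermitian. That $A=(A_{ij})$ is an $n\times n$ block matrix means that $A$ is partitioned into blocks $A_{ij}$, $1\le i,j\le n$; since every block is square, all blocks have the same size. $A$ is block diagonal if $A_{ij}=0$ for all $i\ne j$.
   Formalization: The equality criterion is stated except when n=2 and the blocks are 1×1, where it is false: for A=[[2,1],[1,2]] one has det A+|A_12||A_21|=3+1=4=A_11A_22 although A is not diagonal; the inequality itself is stated for all n≥1 and all block sizes ≥1. *)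

theory Defs
  imports "Jordan_Normal_Form.Schur_Decomposition" "HOL-Combinatorics.Permutations"
begin

(* Hermitian together with v^* A v > 0 for v nonzero. The order on complex numbers is that of
   HOL-Library.Complex_Order: z < w means Re z < Re w and Im z = Im w. *)
definition positive_definite :: "complex mat \<Rightarrow> bool" where
  "positive_definite A \<longleftrightarrow>
     square_mat A \<and> mat_adjoint A = A \<and>
     (\<forall>v \<in> carrier_vec (dim_row A). v \<noteq> 0\<^sub>v (dim_row A) \<longrightarrow> 0 < (A *\<^sub>v v) \<bullet>c v)"

(* A matrix of size n * m is read as an n x n array of m x m blocks. As for matrix entries,
   block indices start at 0, so the index set {1,...,n} becomes {..<n}. *)
definition block :: "nat \<Rightarrow> 'a mat \<Rightarrow> nat \<Rightarrow> nat \<Rightarrow> 'a mat" where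
  "block m A i j = mat m m (\<lambda>(a, b). A $$ (i * m + a, j * m + b))"

definition block_diagonal :: "nat \<Rightarrow> nat \<Rightarrow> 'a::zero mat \<Rightarrow> bool" where
  "block_diagonal n m A \<longleftrightarrow> (\<forall>i<n. \<forall>j<n. i \<noteq> j \<longrightarrow> block m A i j = 0\<^sub>m m m)"

definition derangements :: "nat \<Rightarrow> (nat \<Rightarrow> nat) set" where
  "derangements n = {\<tau>. \<tau> permutes {..<n} \<and> (\<forall>i<n. \<tau> i \<noteq> i)}"

end

theory Submission
  imports Defs
begin

text \<open>
  If \<open>S\<close> is positive definite and \<open>T\<close> positive semidefinite, the eigenvalues of the inverse of \<open>S\<close>
  times \<open>T\<close> are nonnegative, so \<open>det S + det T \<le> det (S + T)\<close>. Applied to the Schur complement of a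
  diagonal block, this bounds the determinant of the principal submatrix on two blocks \<open>i \<noteq> j\<close> by
  \<open>d i * d j - \<bar>det A\<^sub>i\<^sub>j\<bar>\<^sup>2\<close>, where \<open>d i = det A\<^sub>i\<^sub>i\<close>; splitting off the remaining blocks with
  Fischer's inequality gives \<open>det A \<le> D * (1 - q)\<close> with \<open>D\<close> the product of all \<open>d i\<close> and
  \<open>q = \<bar>det A\<^sub>i\<^sub>j\<bar>\<^sup>2 / (d i * d j)\<close>. Take \<open>j = \<tau> i\<close> with \<open>i\<close> chosen such that \<open>q\<close> is maximal. As each
  \<open>d i\<close> occurs twice in the product of all the ratios \<open>q\<close>, the product of the \<open>\<bar>det A\<^sub>i\<^sub>,\<^sub>\<tau>\<^sub>i\<bar>\<close> is at most
  \<open>D\<close> times the power \<open>n/2\<close> of \<open>q\<close>, hence at most \<open>D * q\<close>. If equality holds and \<open>n \<ge> 3\<close> or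
  \<open>m \<ge> 2\<close>, then \<open>q = 0\<close> and \<open>det A = D\<close>, and equality in Fischer's inequality makes the off-diagonal
  blocks vanish.
\<close>

subsection \<open>Adjoints and definite matrices\<close>

lemma index_mat_adjoint [simp]:
  fixes A :: "complex mat"
  assumes "i < dim_col A" "j < dim_row A"
  shows "mat_adjoint A $$ (i, j) = cnj (A $$ (j, i))"
  using assms by (simp add: mat_adjoint_def mat_of_rows_def)

lemma dim_mat_adjoint [simp]:
  "dim_row (mat_adjoint A) = dim_col A" "dim_col (mat_adjoint A) = dim_row A"
  by (simp_all add: mat_adjoint_def)

lemma mat_adjoint_carrier [simp]:
  "A \<in> carrier_mat nr nc \<Longrightarrow> mat_adjoint A \<in> carrier_mat nc nr"
  by (metis carrier_matD carrier_matI dim_mat_adjoint)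

lemma mat_adjoint_adjoint [simp]:
  fixes A :: "complex mat"
  shows "mat_adjoint (mat_adjoint A) = A"
  by (rule eq_matI) auto

lemma mat_adjoint_mult:
  fixes A B :: "complex mat"
  assumes "A \<in> carrier_mat k l" "B \<in> carrier_mat l r"
  shows "mat_adjoint (A * B) = mat_adjoint B * mat_adjoint A"
  using assms by (intro eq_matI) (auto simp: scalar_prod_def intro!: sum.cong)

lemma det_mat_adjoint:
  fixes A :: "complex mat"
  assumes "A \<in> carrier_mat n n"
  shows "det (mat_adjoint A) = cnj (det A)"
proof -
  \<comment> \<open>The interpretation makes available that \<open>det\<close> commutes with
    applying \<open>cnj\<close> to every entry.\<close>
  interpret cnj_hom: comm_ring_hom cnj by unfold_locales auto
  have "mat_adjoint A = map_mat cnj (transpose_mat A)"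
    using assms by (intro eq_matI) auto
  with assms show ?thesis by (simp add: det_transpose)
qed

lemma cscalar_prod_mat_adjoint:
  fixes A :: "complex mat"
  assumes A: "A \<in> carrier_mat k l" and v: "v \<in> carrier_vec l" and w: "w \<in> carrier_vec k"
  shows "(A *\<^sub>v v) \<bullet>c w = v \<bullet>c (mat_adjoint A *\<^sub>v w)"
proof -
  have "(A *\<^sub>v v) \<bullet>c w = (\<Sum>i<k. \<Sum>j<l. A $$ (i, j) * v $ j * cnj (w $ i))"
    using assms by (simp add: scalar_prod_def atLeast0LessThan sum_distrib_right)
  also have "\<dots> = (\<Sum>j<l. \<Sum>i<k. A $$ (i, j) * v $ j * cnj (w $ i))"
    by (rule sum.swap)
  also have "\<dots> = v \<bullet>c (mat_adjoint A *\<^sub>v w)"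
    using assms by (auto simp: scalar_prod_def atLeast0LessThan sum_distrib_left mult_ac
        intro!: sum.cong)
  finally show ?thesis .
qed

text \<open>The part of a diagonal block that a Schur complement removes is in general only
  semidefinite. As in \<open>positive_definite\<close>, the order on complex numbers makes the form
  real.\<close>

definition positive_semidefinite :: "complex mat \<Rightarrow> bool" where
  "positive_semidefinite A \<longleftrightarrow>
     square_mat A \<and> mat_adjoint A = A \<and>
     (\<forall>v \<in> carrier_vec (dim_row A). 0 \<le> (A *\<^sub>v v) \<bullet>c v)"

lemma positive_definite_imp_semidefinite:
  assumes "positive_definite A"
  shows "positive_semidefinite A"
  unfolding positive_semidefinite_def
proof (intro conjI ballI)
  fix v :: "complex vec" assume v: "v \<in> carrier_vec (dim_row A)"
  show "0 \<le> (A *\<^sub>v v) \<bullet>c v"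
  proof (cases "v = 0\<^sub>v (dim_row A)")
    case True
    with assms show ?thesis
      by (simp add: positive_definite_def mult_mat_vec_def scalar_prod_def)
  next
    case False
    with assms v show ?thesis unfolding positive_definite_def by (meson less_imp_le)
  qed
qed (use assms in \<open>auto simp: positive_definite_def\<close>)

lemma positive_definite_one: "positive_definite (1\<^sub>m n)"
proof -
  have "mat_adjoint (1\<^sub>m n) = (1\<^sub>m n :: complex mat)" by (rule eq_matI) auto
  then show ?thesis by (auto simp: positive_definite_def)
qed

lemma positive_definite_adjoint: "positive_definite A \<Longrightarrow> mat_adjoint A = A"
  by (simp add: positive_definite_def)

lemma positive_definite_kernel:
  assumes "positive_definite A" "A \<in> carrier_mat n n" "v \<in> carrier_vec n"
    and "(A *\<^sub>v v) \<bullet>c v = 0"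
  shows "v = 0\<^sub>v n"
  using assms unfolding positive_definite_def by fastforce

text \<open>A nonzero kernel vector would annihilate the form, so definiteness forces
  \<open>det A\<close> to be nonzero.\<close>

lemma positive_definite_inverse:
  assumes A: "positive_definite A" "A \<in> carrier_mat n n"
  obtains B where "B \<in> carrier_mat n n" "A * B = 1\<^sub>m n" "B * A = 1\<^sub>m n"
proof -
  have "det A \<noteq> 0"
  proof
    assume "det A = 0"
    then obtain v where v: "v \<in> carrier_vec n" "v \<noteq> 0\<^sub>v n" "A *\<^sub>v v = 0\<^sub>v n"
      using det_0_iff_vec_prod_zero_field[OF A(2)] by auto
    then have "(A *\<^sub>v v) \<bullet>c v = 0" by simp
    with positive_definite_kernel[OF A v(1)] v(2) show False by blast
  qed
  \<comment> \<open>The argument \<open>()\<close> fills the extension slot of the matrix ring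
    record; a unit of that ring has a two-sided inverse.\<close>
  from det_non_zero_imp_unit[OF A(2) this, of "()"] that show thesis
    by (auto simp: Units_def ring_mat_def)
qed

lemma mat_eq_zeroI:
  fixes A :: "complex mat"
  assumes A: "A \<in> carrier_mat k l" and "\<And>v. v \<in> carrier_vec l \<Longrightarrow> A *\<^sub>v v = 0\<^sub>v k"
  shows "A = 0\<^sub>m k l"
proof (rule eq_matI)
  fix i j assume ij: "i < dim_row (0\<^sub>m k l :: complex mat)" "j < dim_col (0\<^sub>m k l :: complex mat)"
  then have "A *\<^sub>v unit_vec l j = 0\<^sub>v k" using assms by auto
  then have "(A *\<^sub>v unit_vec l j) $ i = 0" using ij by simp
  with A ij show "A $$ (i, j) = 0\<^sub>m k l $$ (i, j)" by simp
qed (use A in auto)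

text \<open>Moving \<open>mat_adjoint E\<close> across the inner product turns the form at
  \<open>v\<close> into the form of \<open>A\<close> at \<open>E *\<^sub>v v\<close>.
  \<open>E\<close> may be rectangular, which covers the selection of a principal submatrix.\<close>

lemma positive_semidefinite_congruence:
  assumes A: "positive_semidefinite A" "A \<in> carrier_mat k k" and E: "E \<in> carrier_mat k l"
  shows "positive_semidefinite (mat_adjoint E * A * E)"
    "v \<in> carrier_vec l \<Longrightarrow> ((mat_adjoint E * A * E) *\<^sub>v v) \<bullet>c v = (A *\<^sub>v (E *\<^sub>v v)) \<bullet>c (E *\<^sub>v v)"
proof -
  show form: "((mat_adjoint E * A * E) *\<^sub>v v) \<bullet>c v = (A *\<^sub>v (E *\<^sub>v v)) \<bullet>c (E *\<^sub>v v)"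
    if "v \<in> carrier_vec l" for v
  proof -
    have "(mat_adjoint E * A * E) *\<^sub>v v = mat_adjoint E *\<^sub>v (A *\<^sub>v (E *\<^sub>v v))"
      using that A E by (simp add: assoc_mult_mat_vec[of _ l k] assoc_mult_mat_vec[of _ l k _ l]
          mult_carrier_mat[of _ l k])
    then show ?thesis
      using cscalar_prod_mat_adjoint[of "mat_adjoint E" l k "A *\<^sub>v (E *\<^sub>v v)" v] that A E by simp
  qed
  have adj: "mat_adjoint (mat_adjoint E * A * E) = mat_adjoint E * A * E"
    using A E
    by (simp add: mat_adjoint_mult[of _ l k _ l] mat_adjoint_mult[of _ l k _ k] positive_semidefinite_def
        mult_carrier_mat[of _ l k])
      (simp add: assoc_mult_mat[of _ l k _ k _ l])
  show "positive_semidefinite (mat_adjoint E * A * E)"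
    unfolding positive_semidefinite_def
  proof (intro conjI ballI adj)
    fix v :: "complex vec" assume "v \<in> carrier_vec (dim_row (mat_adjoint E * A * E))"
    then have v: "v \<in> carrier_vec l" using E by auto
    with E A show "0 \<le> ((mat_adjoint E * A * E) *\<^sub>v v) \<bullet>c v"
      unfolding form[OF v] by (auto simp: positive_semidefinite_def)
  qed (use E in auto)
qed

text \<open>Injectivity of \<open>E\<close> keeps nonzero vectors nonzero, so strict positivity
  survives.\<close>

lemma positive_definite_congruence:
  assumes A: "positive_definite A" "A \<in> carrier_mat k k" and E: "E \<in> carrier_mat k l"
    and inj: "\<And>v. v \<in> carrier_vec l \<Longrightarrow> E *\<^sub>v v = 0\<^sub>v k \<Longrightarrow> v = 0\<^sub>v l"
  shows "positive_definite (mat_adjoint E * A * E)"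
proof -
  note psd = positive_semidefinite_congruence[OF positive_definite_imp_semidefinite[OF A(1)] A(2) E]
  show ?thesis
    unfolding positive_definite_def
  proof (intro conjI ballI impI)
    fix v :: "complex vec"
    assume "v \<in> carrier_vec (dim_row (mat_adjoint E * A * E))"
      and "v \<noteq> 0\<^sub>v (dim_row (mat_adjoint E * A * E))"
    then have v: "v \<in> carrier_vec l" "v \<noteq> 0\<^sub>v l" using E by auto
    with inj have "E *\<^sub>v v \<noteq> 0\<^sub>v k" by blast
    with A E v(1) show "0 < ((mat_adjoint E * A * E) *\<^sub>v v) \<bullet>c v"
      unfolding psd(2)[OF v(1)] positive_definite_def by auto
  qed (use psd(1) in \<open>auto simp: positive_semidefinite_def\<close>)
qed

subsection \<open>Superadditivity of the determinant\<close>

text \<open>Strict triangularity expresses column \<open>j\<close> through unit vectors before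
  \<open>j\<close>, whose images vanish by induction. So \<open>B\<close> kills column
  \<open>j\<close>, the image of \<open>unit_vec n j\<close>, and the kernel hypothesis makes that
  column zero.\<close>

lemma strictly_upper_triangular_square_kernel:
  fixes B :: "'a :: field mat"
  assumes B: "B \<in> carrier_mat n n" "upper_triangular B" and diag: "\<And>i. i < n \<Longrightarrow> B $$ (i, i) = 0"
    and ker: "\<And>v. v \<in> carrier_vec n \<Longrightarrow> B *\<^sub>v (B *\<^sub>v v) = 0\<^sub>v n \<Longrightarrow> B *\<^sub>v v = 0\<^sub>v n"
  shows "B = 0\<^sub>m n n"
proof -
  have col: "j < n \<Longrightarrow> col B j = 0\<^sub>v n" for j
  proof (induction j rule: less_induct)
    case (less j)
    have e: "B *\<^sub>v unit_vec n j = col B j"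
      using B(1) less.prems by (intro eq_vecI) auto
    have "B *\<^sub>v col B j = 0\<^sub>v n"
    proof (rule eq_vecI)
      fix r assume r: "r < dim_vec (0\<^sub>v n :: 'a vec)"
      have "(B *\<^sub>v col B j) $ r = (\<Sum>i<n. B $$ (r, i) * B $$ (i, j))"
        using B(1) r less.prems by (auto simp: scalar_prod_def atLeast0LessThan)
      also have "\<dots> = 0"
      proof (rule sum.neutral, safe)
        fix i assume i: "i < n"
        consider "i < j" | "i = j" | "j < i" by linarith
        then show "B $$ (r, i) * B $$ (i, j) = 0"
        proof cases
          case 1
          with less.IH i have "col B i $ r = 0" using r by simp
          with B(1) r i show ?thesis by simp
        next
          case 2
          with diag i show ?thesis by simp
        next
          case 3
          with B i show ?thesis by (auto simp: upper_triangular_def)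
        qed
      qed
      finally show "(B *\<^sub>v col B j) $ r = 0\<^sub>v n $ r" using r by simp
    qed (use B in auto)
    with ker[of "unit_vec n j"] e show ?case by simp
  qed
  show ?thesis
  proof (rule eq_matI)
    fix i j assume ij: "i < dim_row (0\<^sub>m n n :: 'a mat)" "j < dim_col (0\<^sub>m n n :: 'a mat)"
    with col[of j] have "col B j $ i = 0" by simp
    with B ij show "B $$ (i, j) = 0\<^sub>m n n $$ (i, j)" by simp
  qed (use B in auto)
qed

text \<open>The \<open>b i\<close> are the eigenvalues of the inverse of \<open>S\<close> times \<open>T\<close>.\<close>

lemma positive_pencil:
  assumes S: "positive_definite S" "S \<in> carrier_mat n n"
    and T: "positive_semidefinite T" "T \<in> carrier_mat n n"
  obtains b :: "nat \<Rightarrow> real" where "\<And>i. i < n \<Longrightarrow> 0 \<le> b i"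
    and "det T = det S * complex_of_real (\<Prod>i<n. b i)"
    and "det (S + T) = det S * complex_of_real (\<Prod>i<n. 1 + b i)"
    and "(\<And>i. i < n \<Longrightarrow> b i = 0) \<Longrightarrow> T = 0\<^sub>m n n"
proof -
  obtain R where R: "R \<in> carrier_mat n n" "S * R = 1\<^sub>m n" "R * S = 1\<^sub>m n"
    using positive_definite_inverse[OF S] .
  define M where "M = R * T"
  have M: "M \<in> carrier_mat n n" using R T by (simp add: M_def)
  have SM: "S * M = T"
    using S R T by (simp add: M_def assoc_mult_mat[symmetric, of _ n n _ n _ n])
  \<comment> \<open>Over the complex numbers the characteristic polynomial splits, so
    \<open>M\<close> is similar to an upper triangular \<open>B\<close> with the eigenvalues on its
    diagonal.\<close>
  obtain es where "char_poly M = (\<Prod>a\<leftarrow>es. [:- a, 1:])"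
    using char_poly_factorized[OF M] by blast
  then obtain B where B: "B \<in> carrier_mat n n" "upper_triangular B" and sim: "similar_mat M B"
    using schur_decomposition_exists[OF M] by blast
  then obtain P Q where "similar_mat_wit M B P Q" unfolding similar_mat_def by blast
  note PQ = similar_mat_witD2[OF M this]
  have ev: "0 \<le> B $$ (i, i)" if i: "i < n" for i
  proof -
    have "poly (char_poly B) (B $$ (i, i)) = 0"
    proof -
      have "B $$ (i, i) \<in> set (diag_mat B)" using B i by (auto simp: diag_mat_def)
      then show ?thesis
        unfolding char_poly_upper_triangular[OF B] poly_prod_list
        by (force simp: prod_list_zero_iff)
    qed
    then have "eigenvalue M (B $$ (i, i))"
      using eigenvalue_root_char_poly[OF M] char_poly_similar[OF sim] by simp
    then obtain v where v: "v \<in> carrier_vec n" "v \<noteq> 0\<^sub>v n" "M *\<^sub>v v = B $$ (i, i) \<cdot>\<^sub>v v"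
      using M by (auto simp: eigenvalue_def eigenvector_def)
    \<comment> \<open>Pairing \<open>T v = \<lambda> S v\<close> with \<open>v\<close> writes the
      eigenvalue as the quotient of a nonnegative by a positive number.\<close>
    have "T *\<^sub>v v = S *\<^sub>v (M *\<^sub>v v)"
      using SM S M v by (metis assoc_mult_mat_vec)
    also have "\<dots> = B $$ (i, i) \<cdot>\<^sub>v (S *\<^sub>v v)"
      using v S by (simp add: mult_mat_vec[of _ n n])
    finally have "(T *\<^sub>v v) \<bullet>c v = B $$ (i, i) * ((S *\<^sub>v v) \<bullet>c v)"
      using S v by (simp add: smult_scalar_prod_distrib[of _ n])
    moreover have "0 < (S *\<^sub>v v) \<bullet>c v" "0 \<le> (T *\<^sub>v v) \<bullet>c v"
      using S T v by (auto simp: positive_definite_def positive_semidefinite_def)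
    ultimately show ?thesis
      by (auto simp: less_eq_complex_def less_complex_def zero_le_mult_iff)
  qed
  define b where "b i = Re (B $$ (i, i))" for i
  have Bb: "B $$ (i, i) = complex_of_real (b i)" if "i < n" for i
    using ev[OF that] by (simp add: b_def complex_eq_iff less_eq_complex_def)
  have detB: "det B = complex_of_real (\<Prod>i<n. b i)"
    using B by (simp add: det_upper_triangular[OF B(2,1)] diag_mat_def Bb atLeast0LessThan
        prod.distinct_set_conv_list[symmetric])
  have up1: "upper_triangular (1\<^sub>m n + B)" "1\<^sub>m n + B \<in> carrier_mat n n"
    using B by (auto simp: upper_triangular_def)
  have det1B: "det (1\<^sub>m n + B) = complex_of_real (\<Prod>i<n. 1 + b i)"
    using B by (simp add: det_upper_triangular[OF up1] diag_mat_def Bb atLeast0LessThan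
        prod.distinct_set_conv_list[symmetric])
  have detT: "det T = det S * det B"
    using det_mult[OF S(2) M] det_similar[OF sim] SM by simp
  \<comment> \<open>The similarity between \<open>M\<close> and \<open>B\<close> is also one between
    \<open>1 + M\<close> and \<open>1 + B\<close>, whose diagonal entries are the
    \<open>1 + b i\<close>.\<close>
  have "1\<^sub>m n + M = P * (1\<^sub>m n + B) * Q"
    using PQ B by (simp add: mult_add_distrib_mat[of _ n n _ n] add_mult_distrib_mat[of _ n n _ _ n])
  moreover have "det P * det Q = 1" using PQ by (simp add: det_mult[symmetric, of _ n])
  ultimately have "det (1\<^sub>m n + M) = det (1\<^sub>m n + B)"
    using PQ B by (simp add: det_mult[of _ n] mult_ac)
  moreover have "S + T = S * (1\<^sub>m n + M)"
    using S M SM by (simp add: mult_add_distrib_mat[of _ n n _ n])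
  ultimately have detST: "det (S + T) = det S * det (1\<^sub>m n + B)"
    using S M by (simp add: det_mult[of _ n])
  have T0: "T = 0\<^sub>m n n" if b0: "\<And>i. i < n \<Longrightarrow> b i = 0"
  proof -
    \<comment> \<open>\<open>M\<close> is self-adjoint for the inner product defined by \<open>S\<close>, so \<open>M\<^sup>2\<close> and \<open>M\<close> have the same kernel.\<close>
    have kerM: "M *\<^sub>v v = 0\<^sub>v n" if v: "v \<in> carrier_vec n" and "M *\<^sub>v (M *\<^sub>v v) = 0\<^sub>v n" for v
    proof -
      have MV: "M *\<^sub>v v \<in> carrier_vec n" using M v by simp
      have "T *\<^sub>v (M *\<^sub>v v) = S *\<^sub>v (M *\<^sub>v (M *\<^sub>v v))" using SM S M MV by (metis assoc_mult_mat_vec)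
      then have "T *\<^sub>v (M *\<^sub>v v) = 0\<^sub>v n" using that S by (intro eq_vecI) auto
      then have "0 = (T *\<^sub>v (M *\<^sub>v v)) \<bullet>c v" using v by simp
      also have "\<dots> = (M *\<^sub>v v) \<bullet>c (T *\<^sub>v v)"
        using cscalar_prod_mat_adjoint[OF T(2) MV v] T(1) by (simp add: positive_semidefinite_def)
      also have "T *\<^sub>v v = S *\<^sub>v (M *\<^sub>v v)" using SM S M v by (metis assoc_mult_mat_vec)
      also have "(M *\<^sub>v v) \<bullet>c \<dots> = (S *\<^sub>v (M *\<^sub>v v)) \<bullet>c (M *\<^sub>v v)"
        using cscalar_prod_mat_adjoint[OF S(2) MV MV] S(1) by (simp add: positive_definite_def)
      finally show ?thesis using positive_definite_kernel[OF S MV] by simp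
    qed
    have MP: "M *\<^sub>v (P *\<^sub>v w) = P *\<^sub>v (B *\<^sub>v w)" if w: "w \<in> carrier_vec n" for w
    proof -
      have "M * P = P * B"
        using PQ B by (simp add: assoc_mult_mat[of _ n n _ n _ n])
      then show ?thesis using M PQ B w by (metis assoc_mult_mat_vec)
    qed
    have kerP: "w = 0\<^sub>v n" if w: "w \<in> carrier_vec n" and "P *\<^sub>v w = 0\<^sub>v n" for w
    proof -
      have "w = Q *\<^sub>v (P *\<^sub>v w)" using PQ w by (simp add: assoc_mult_mat_vec[symmetric, of _ n n _ n])
      with that PQ show ?thesis by auto
    qed
    \<comment> \<open>The kernel property of \<open>M\<close> passes to \<open>B\<close> through the
      injective \<open>P\<close>; with vanishing eigenvalues \<open>B\<close> is strictly
      triangular.\<close>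
    have "B = 0\<^sub>m n n"
    proof (rule strictly_upper_triangular_square_kernel[OF B])
      show "B $$ (i, i) = 0" if "i < n" for i using Bb[OF that] b0[OF that] by simp
      show "B *\<^sub>v w = 0\<^sub>v n" if w: "w \<in> carrier_vec n" and "B *\<^sub>v (B *\<^sub>v w) = 0\<^sub>v n" for w
      proof -
        have "M *\<^sub>v (M *\<^sub>v (P *\<^sub>v w)) = P *\<^sub>v (B *\<^sub>v (B *\<^sub>v w))"
          using MP w B by simp
        also have "\<dots> = 0\<^sub>v n" using that PQ by auto
        finally have "M *\<^sub>v (P *\<^sub>v w) = 0\<^sub>v n" using kerM PQ w by simp
        then show ?thesis using kerP MP w B by simp
      qed
    qed
    then have "M = 0\<^sub>m n n" using PQ by simp
    then show ?thesis using SM S by simp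
  qed
  show thesis
    using that[of b, OF _ detT[unfolded detB] detST[unfolded det1B] T0] ev
    by (simp add: b_def less_eq_complex_def)
qed

text \<open>In the expanded product all terms are nonnegative, and \<open>1\<close> and the product
  of the \<open>b i\<close> are two of them. With at least two factors and all \<open>b i\<close>
  positive, mixed terms remain, whence strictness.\<close>

lemma prod_one_plus_ge:
  fixes b :: "'a \<Rightarrow> real"
  assumes "finite I" "\<And>i. i \<in> I \<Longrightarrow> 0 \<le> b i"
  shows "J \<subseteq> I \<Longrightarrow> (\<Prod>i\<in>J. 1 + b i) \<le> (\<Prod>i\<in>I. 1 + b i)"
    and "I \<noteq> {} \<Longrightarrow> 1 + (\<Prod>i\<in>I. b i) \<le> (\<Prod>i\<in>I. 1 + b i)"
    and "2 \<le> card I \<Longrightarrow> (\<And>i. i \<in> I \<Longrightarrow> b i \<noteq> 0) \<Longrightarrow> 1 + (\<Prod>i\<in>I. b i) < (\<Prod>i\<in>I. 1 + b i)"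
proof -
  show mono: "(\<Prod>i\<in>J. 1 + b i) \<le> (\<Prod>i\<in>I. 1 + b i)" if "J \<subseteq> I" for J
    by (rule prod_mono2) (use assms that in \<open>auto intro: add_nonneg_nonneg\<close>)
  have ge: "1 + (\<Prod>i\<in>J. b i) \<le> (\<Prod>i\<in>J. 1 + b i)" if "J \<noteq> {}" "J \<subseteq> I" for J
    using finite_subset[OF that(2) assms(1)] that
  proof (induction rule: finite_ne_induct)
    case (insert x F)
    have "0 \<le> b x" "0 \<le> (\<Prod>i\<in>F. b i)" using insert assms by (auto intro!: prod_nonneg)
    then have "1 + b x * (\<Prod>i\<in>F. b i) \<le> (1 + b x) * (1 + (\<Prod>i\<in>F. b i))"
      by (simp add: algebra_simps)
    also have "\<dots> \<le> (1 + b x) * (\<Prod>i\<in>F. 1 + b i)"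
      using insert \<open>0 \<le> b x\<close> by (intro mult_left_mono) auto
    finally show ?case using insert by simp
  qed simp
  then show "1 + (\<Prod>i\<in>I. b i) \<le> (\<Prod>i\<in>I. 1 + b i)" if "I \<noteq> {}" using that by simp
  show "1 + (\<Prod>i\<in>I. b i) < (\<Prod>i\<in>I. 1 + b i)" if c: "2 \<le> card I" and nz: "\<And>i. i \<in> I \<Longrightarrow> b i \<noteq> 0"
  proof -
    obtain x where x: "x \<in> I" using c by fastforce
    define J where "J = I - {x}"
    have "card J = card I - 1" using assms(1) x by (simp add: J_def)
    with c have "card J \<noteq> 0" by simp
    then have J: "J \<subseteq> I" "J \<noteq> {}" by (auto simp: J_def[symmetric]) (simp add: J_def)
    have pos: "0 < b i" if "i \<in> I" for i using assms(2) nz that by (simp add: less_le)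
    have "0 < b x" "0 < (\<Prod>i\<in>J. b i)" using x J pos by (auto intro!: prod_pos)
    then have "1 + b x * (\<Prod>i\<in>J. b i) < (1 + b x) * (1 + (\<Prod>i\<in>J. b i))"
      by (simp add: algebra_simps)
    also have "\<dots> \<le> (1 + b x) * (\<Prod>i\<in>J. 1 + b i)"
      using ge[OF J(2,1)] \<open>0 < b x\<close> by (intro mult_left_mono) auto
    finally show ?thesis using prod.remove[OF assms(1) x] unfolding J_def by metis
  qed
qed

lemma prod_one_plus_gt_one:
  fixes b :: "'a \<Rightarrow> real"
  assumes "finite I" "\<And>i. i \<in> I \<Longrightarrow> 0 \<le> b i" "j \<in> I" "b j \<noteq> 0"
  shows "1 < (\<Prod>i\<in>I. 1 + b i)"
proof -
  have "0 < b j" using assms(2)[OF assms(3)] assms(4) by simp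
  moreover have "1 + b j \<le> (\<Prod>i\<in>I. 1 + b i)"
    using prod_one_plus_ge(1)[where I = I and b = b and J = "{j}"] assms(1-3) by simp
  ultimately show ?thesis by simp
qed

text \<open>By \<open>positive_pencil\<close> with the identity as \<open>S\<close>, the determinant
  is a product of nonnegative reals; invertibility excludes zero.\<close>

lemma det_positive_definite:
  assumes "positive_definite A" "A \<in> carrier_mat n n"
  shows "0 < Re (det A)" "det A = complex_of_real (Re (det A))"
proof -
  obtain b where b: "\<And>i. i < n \<Longrightarrow> 0 \<le> b i"
    "det A = det (1\<^sub>m n) * complex_of_real (\<Prod>i<n. b i)"
    by (rule positive_pencil[OF positive_definite_one _
          positive_definite_imp_semidefinite[OF assms(1)] assms(2)]) auto
  obtain B where "B \<in> carrier_mat n n" "A * B = 1\<^sub>m n"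
    using positive_definite_inverse[OF assms] .
  with assms have "det A * det B = 1" by (metis det_mult det_one)
  then have "det A \<noteq> 0" by auto
  moreover have "0 \<le> (\<Prod>i<n. b i)" using b(1) by (intro prod_nonneg) auto
  ultimately show "0 < Re (det A)" "det A = complex_of_real (Re (det A))"
    unfolding b(2) det_one mult_1 Re_complex_of_real by (auto simp: less_le)
qed

lemma Re_det_mult_positive_definite:
  assumes "positive_definite A" "A \<in> carrier_mat n n"
  shows "Re (det A * z) = Re (det A) * Re z"
proof -
  have "Im (det A) = 0" using det_positive_definite(2)[OF assms] by (metis Im_complex_of_real)
  then show ?thesis by simp
qed

text \<open>After division by \<open>det S\<close> these are inequalities between products of the
  \<open>b i\<close> and the \<open>1 + b i\<close> of the pencil. The size bounds matter: an empty
  matrix has determinant \<open>1\<close>, and for size \<open>1\<close> the determinant is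
  additive.\<close>

lemma det_add_positive:
  assumes S: "positive_definite S" "S \<in> carrier_mat n n"
    and T: "positive_semidefinite T" "T \<in> carrier_mat n n"
  shows "Re (det S) \<le> Re (det (S + T))"
    and "T \<noteq> 0\<^sub>m n n \<Longrightarrow> Re (det S) < Re (det (S + T))"
    and "1 \<le> n \<Longrightarrow> Re (det S) + cmod (det T) \<le> Re (det (S + T))"
    and "2 \<le> n \<Longrightarrow> det T \<noteq> 0 \<Longrightarrow> Re (det S) + cmod (det T) < Re (det (S + T))"
proof -
  obtain b where b: "\<And>i. i < n \<Longrightarrow> 0 \<le> b i"
    and dT: "det T = det S * complex_of_real (\<Prod>i<n. b i)"
    and dST: "det (S + T) = det S * complex_of_real (\<Prod>i<n. 1 + b i)"
    and zero: "(\<And>i. i < n \<Longrightarrow> b i = 0) \<Longrightarrow> T = 0\<^sub>m n n"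
    using positive_pencil[OF S T] by metis
  have pos: "0 < Re (det S)" "Im (det S) = 0"
    using det_positive_definite[OF S] by (auto simp: complex_eq_iff)
  then have cS: "cmod (det S) = Re (det S)" by (simp add: cmod_eq_Re)
  have "0 \<le> (\<Prod>i<n. b i)" using b by (intro prod_nonneg) auto
  then have T': "cmod (det T) = Re (det S) * (\<Prod>i<n. b i)"
    unfolding dT norm_mult norm_of_real cS by simp
  have ST': "Re (det (S + T)) = Re (det S) * (\<Prod>i<n. 1 + b i)"
    unfolding dST Re_det_mult_positive_definite[OF S] Re_complex_of_real ..
  note ge = prod_one_plus_ge[where I = "{..<n}" and b = b, OF _ b]
  show "Re (det S) \<le> Re (det (S + T))"
    using ge(1)[of "{}"] pos unfolding ST' by simp
  show "Re (det S) < Re (det (S + T))" if T0: "T \<noteq> 0\<^sub>m n n"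
  proof -
    obtain j where "j < n" "b j \<noteq> 0" using zero T0 by blast
    then have "1 < (\<Prod>i<n. 1 + b i)" using b by (intro prod_one_plus_gt_one) auto
    with pos show ?thesis unfolding ST' by simp
  qed
  show "Re (det S) + cmod (det T) \<le> Re (det (S + T))" if "1 \<le> n"
  proof -
    have "1 + (\<Prod>i<n. b i) \<le> (\<Prod>i<n. 1 + b i)" using ge(2) that by (simp add: lessThan_empty_iff)
    with pos have "Re (det S) * (1 + (\<Prod>i<n. b i)) \<le> Re (det S) * (\<Prod>i<n. 1 + b i)"
      by (intro mult_left_mono) auto
    then show ?thesis unfolding T' ST' by (simp add: distrib_left)
  qed
  show "Re (det S) + cmod (det T) < Re (det (S + T))" if "2 \<le> n" "det T \<noteq> 0"
  proof -
    have "(\<Prod>i<n. b i) \<noteq> 0" using that(2) unfolding dT by auto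
    then have "1 + (\<Prod>i<n. b i) < (\<Prod>i<n. 1 + b i)" using ge(3) that by auto
    with pos have "Re (det S) * (1 + (\<Prod>i<n. b i)) < Re (det S) * (\<Prod>i<n. 1 + b i)"
      by (intro mult_strict_left_mono) auto
    then show ?thesis unfolding T' ST' by (simp add: distrib_left)
  qed
qed

subsection \<open>Schur complements and principal submatrices\<close>

text \<open>\<open>T\<close> is the adjoint of \<open>C\<close> times the inverse of
  \<open>X\<close> times \<open>C\<close>, and \<open>S = Y - T\<close> is the Schur complement.
  Definiteness of \<open>X\<close> lets \<open>T\<close> vanish only together with \<open>C\<close>;
  the last claim converts the term \<open>det T\<close> of superadditivity into the squared modulus
  of \<open>det C\<close>.\<close>

lemma schur_complement:
  assumes X: "positive_definite X" "X \<in> carrier_mat k k"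
    and C: "C \<in> carrier_mat k l" and Y: "Y \<in> carrier_mat l l"
    and P: "positive_definite (four_block_mat X C (mat_adjoint C) Y)"
  obtains S T where "positive_definite S" "S \<in> carrier_mat l l"
    and "positive_semidefinite T" "T \<in> carrier_mat l l" and "Y = S + T"
    and "det (four_block_mat X C (mat_adjoint C) Y) = det X * det S"
    and "T = 0\<^sub>m l l \<Longrightarrow> C = 0\<^sub>m k l"
    and "k = l \<Longrightarrow> Re (det X) * cmod (det T) = (cmod (det C))\<^sup>2"
proof -
  let ?P = "four_block_mat X C (mat_adjoint C) Y"
  obtain R where R: "R \<in> carrier_mat k k" "X * R = 1\<^sub>m k" "R * X = 1\<^sub>m k"
    using positive_definite_inverse[OF X] .
  \<comment> \<open>\<open>G\<close> solves \<open>X * G = C\<close>, which makes \<open>T\<close> a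
    congruence of \<open>X\<close> and hence semidefinite.\<close>
  define G where "G = R * C"
  have G: "G \<in> carrier_mat k l" using R C by (simp add: G_def)
  have XG: "X * G = C"
    using X R C by (simp add: G_def assoc_mult_mat[symmetric, of _ k k _ k _ l])
  have aX: "mat_adjoint X = X" using positive_definite_adjoint[OF X(1)] .
  have aC: "mat_adjoint C = mat_adjoint G * X"
    using mat_adjoint_mult[OF X(2) G] XG aX by simp
  define T where "T = mat_adjoint G * X * G"
  have T: "T \<in> carrier_mat l l" unfolding T_def
    using mult_carrier_mat[OF mult_carrier_mat[OF mat_adjoint_carrier[OF G] X(2)] G] .
  have Tpsd: "positive_semidefinite T"
    unfolding T_def using positive_semidefinite_congruence(1) positive_definite_imp_semidefinite X G by blast
  define S where "S = Y - T"
  have S: "S \<in> carrier_mat l l" using Y T by (simp add: S_def minus_carrier_mat)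
  have YST: "Y = S + T" using Y T by (intro eq_matI) (auto simp: S_def)
  have aCG: "mat_adjoint C * G = T" by (simp add: aC T_def)
  have Pc: "?P \<in> carrier_mat (k + l) (k + l)" using X Y by simp
  have aY: "mat_adjoint Y = Y"
  proof (rule eq_matI)
    fix i j assume ij: "i < dim_row Y" "j < dim_col Y"
    have "mat_adjoint ?P $$ (k + i, k + j) = ?P $$ (k + i, k + j)"
      using positive_definite_adjoint[OF P] by simp
    with ij X Y C show "mat_adjoint Y $$ (i, j) = Y $$ (i, j)" by simp
  qed (use Y in auto)
  have aS: "mat_adjoint S = S"
  proof (rule eq_matI)
    fix i j assume ij: "i < dim_row S" "j < dim_col S"
    have "mat_adjoint Y $$ (i, j) = Y $$ (i, j)" "mat_adjoint T $$ (i, j) = T $$ (i, j)"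
      using aY Tpsd by (auto simp: positive_semidefinite_def)
    with ij Y T S show "mat_adjoint S $$ (i, j) = S $$ (i, j)" by (simp add: S_def)
  qed (use S in auto)
  have Spd: "positive_definite S"
    unfolding positive_definite_def
  proof (intro conjI ballI impI aS)
    fix w :: "complex vec"
    assume "w \<in> carrier_vec (dim_row S)" and "w \<noteq> 0\<^sub>v (dim_row S)"
    with S have w: "w \<in> carrier_vec l" "w \<noteq> 0\<^sub>v l" by auto
    \<comment> \<open>The upper part is chosen such that the first \<open>k\<close> entries of
      \<open>?P *\<^sub>v u\<close> vanish; the form at \<open>u\<close> is then that of
      \<open>S\<close> at \<open>w\<close>.\<close>
    define u where "u = (- (G *\<^sub>v w)) @\<^sub>v w"
    have Gw: "G *\<^sub>v w \<in> carrier_vec k" using G w by simp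
    have u: "u \<in> carrier_vec (k + l)" using Gw w by (simp add: u_def)
    have "u \<noteq> 0\<^sub>v (k + l)"
    proof
      assume u0: "u = 0\<^sub>v (k + l)"
      have "w = 0\<^sub>v l"
      proof (rule eq_vecI)
        fix i assume i: "i < dim_vec (0\<^sub>v l :: complex vec)"
        have "u $ (k + i) = 0" using u0 i by simp
        with i Gw w G show "w $ i = 0\<^sub>v l $ i" by (simp add: u_def)
      qed (use w in auto)
      with w show False by simp
    qed
    then have form: "0 < (?P *\<^sub>v u) \<bullet>c u"
      using P Pc u unfolding positive_definite_def by (metis carrier_matD(1))
    have top: "X *\<^sub>v (- (G *\<^sub>v w)) + C *\<^sub>v w = 0\<^sub>v k"
    proof -
      have "C *\<^sub>v w = X *\<^sub>v (G *\<^sub>v w)" using XG X G w by (metis assoc_mult_mat_vec)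
      moreover have "X *\<^sub>v (- (G *\<^sub>v w)) = - (X *\<^sub>v (G *\<^sub>v w))"
        using X Gw G by (intro eq_vecI) auto
      ultimately show ?thesis using X Gw by simp
    qed
    have bot: "mat_adjoint C *\<^sub>v (- (G *\<^sub>v w)) + Y *\<^sub>v w = S *\<^sub>v w"
    proof -
      have "mat_adjoint C *\<^sub>v (G *\<^sub>v w) = T *\<^sub>v w"
        using aCG C G w by (metis assoc_mult_mat_vec mat_adjoint_carrier)
      moreover have "mat_adjoint C *\<^sub>v (- (G *\<^sub>v w)) = - (mat_adjoint C *\<^sub>v (G *\<^sub>v w))"
        using C Gw G by (intro eq_vecI) auto
      moreover have "Y *\<^sub>v w = S *\<^sub>v w + T *\<^sub>v w"
        unfolding YST using S T w(1) by (rule add_mult_distrib_mat_vec)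
      ultimately show ?thesis using S T w by (intro eq_vecI) auto
    qed
    have "?P *\<^sub>v u = 0\<^sub>v k @\<^sub>v (S *\<^sub>v w)"
      unfolding u_def using four_block_mat_mult_vec[OF X(2) C _ Y, of "mat_adjoint C"] C Gw w top bot
      by simp
    moreover have "conjugate u = conjugate (- (G *\<^sub>v w)) @\<^sub>v conjugate w"
      unfolding u_def using Gw w by (intro eq_vecI) auto
    moreover have "(0\<^sub>v k @\<^sub>v (S *\<^sub>v w)) \<bullet> (conjugate (- (G *\<^sub>v w)) @\<^sub>v conjugate w)
        = 0\<^sub>v k \<bullet> conjugate (- (G *\<^sub>v w)) + (S *\<^sub>v w) \<bullet>c w"
      using Gw S w by (intro scalar_prod_append[of _ k _ l]) auto
    ultimately show "0 < (S *\<^sub>v w) \<bullet>c w" using form Gw by simp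
  qed (use S in auto)
  have detP: "det ?P = det X * det S"
  proof -
    \<comment> \<open>Right multiplication by this unitriangular matrix clears the block
      \<open>C\<close> and puts \<open>S\<close> in place of \<open>Y\<close>.\<close>
    let ?U = "four_block_mat (1\<^sub>m k) (- G) (0\<^sub>m l k) (1\<^sub>m l)"
    have "?P * ?U = four_block_mat X (0\<^sub>m k l) (mat_adjoint C) S"
    proof -
      have 1: "X * - G + C * 1\<^sub>m l = 0\<^sub>m k l"
        using X G C XG by (intro eq_matI) (auto simp: uminus_mult_right_mat[symmetric])
      have 2: "mat_adjoint C * - G + Y * 1\<^sub>m l = S"
        using C G Y T by (simp add: S_def aCG[symmetric])
          (intro eq_matI, auto)
      show ?thesis
        using mult_four_block_mat[of X k k C l "mat_adjoint C" l Y "1\<^sub>m k" k "- G" l "0\<^sub>m l k" "1\<^sub>m l"]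
          X C Y G 1 2 by simp
    qed
    moreover have "det ?U = 1"
      using G by (subst det_four_block_mat_lower_left_zero[of _ k _ l]) auto
    moreover have "?U \<in> carrier_mat (k + l) (k + l)" by simp
    ultimately have "det ?P = det (four_block_mat X (0\<^sub>m k l) (mat_adjoint C) S)"
      using det_mult[OF Pc, of ?U] by simp
    also have "\<dots> = det X * det S"
      using X C S by (intro det_four_block_mat_upper_right_zero) auto
    finally show ?thesis .
  qed
  have C0: "C = 0\<^sub>m k l" if "T = 0\<^sub>m l l"
  proof -
    have "G = 0\<^sub>m k l"
    proof (rule mat_eq_zeroI[OF G])
      fix v :: "complex vec" assume v: "v \<in> carrier_vec l"
      have "(X *\<^sub>v (G *\<^sub>v v)) \<bullet>c (G *\<^sub>v v) = (T *\<^sub>v v) \<bullet>c v"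
        unfolding T_def using positive_semidefinite_congruence(2)[OF _ X(2) G v]
          positive_definite_imp_semidefinite[OF X(1)] by simp
      also have "T *\<^sub>v v = 0\<^sub>v l" using that v by (intro eq_vecI) auto
      also have "0\<^sub>v l \<bullet>c v = 0" using v by simp
      finally show "G *\<^sub>v v = 0\<^sub>v k" using positive_definite_kernel[OF X] G v by simp
    qed
    then show ?thesis using XG X by simp
  qed
  have "Re (det X) * cmod (det T) = (cmod (det C))\<^sup>2" if kl: "k = l"
  proof -
    have "cmod (det X) = Re (det X)"
      using det_positive_definite[OF X] by (metis abs_of_pos norm_of_real)
    moreover have "det T = cnj (det C) * det G"
      unfolding aCG[symmetric] using C G kl by (simp add: det_mult[of _ l] det_mat_adjoint)
    moreover have "det C = det X * det G"
      unfolding XG[symmetric] using X G kl by (simp add: det_mult[of _ l])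
    ultimately show ?thesis by (simp add: norm_mult power2_eq_square mult_ac)
  qed
  with that[OF Spd S Tpsd T YST detP C0] show thesis by blast
qed

section \<open>Submatrices along index lists\<close>

lemma index_mult_mat_sum:
  assumes "A \<in> carrier_mat k l" "B \<in> carrier_mat l r" "i < k" "j < r"
  shows "(A * B) $$ (i, j) = (\<Sum>q<l. A $$ (i, q) * B $$ (q, j))"
  using assms by (simp add: scalar_prod_def atLeast0LessThan)

text \<open>Lists fix the order of rows and columns, so appending lists yields a four-block matrix
  and reordering blocks is reordering a list.\<close>

definition sub_mat :: "'a mat \<Rightarrow> nat list \<Rightarrow> nat list \<Rightarrow> 'a mat" where
  "sub_mat A xs ys = mat (length xs) (length ys) (\<lambda>(a, b). A $$ (xs ! a, ys ! b))"

lemma sub_mat_carrier [simp]: "sub_mat A xs ys \<in> carrier_mat (length xs) (length ys)"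
  by (simp add: sub_mat_def)

lemma dim_sub_mat [simp]: "dim_row (sub_mat A xs ys) = length xs" "dim_col (sub_mat A xs ys) = length ys"
  by (simp_all add: sub_mat_def)

lemma index_sub_mat [simp]:
  "i < length xs \<Longrightarrow> j < length ys \<Longrightarrow> sub_mat A xs ys $$ (i, j) = A $$ (xs ! i, ys ! j)"
  by (simp add: sub_mat_def)

lemma sub_mat_append:
  "sub_mat A (xs @ ys) (xs @ ys) =
     four_block_mat (sub_mat A xs xs) (sub_mat A xs ys) (sub_mat A ys xs) (sub_mat A ys ys)"
  by (rule eq_matI) (auto simp: nth_append)

lemma mat_adjoint_sub_mat:
  fixes A :: "complex mat"
  assumes "mat_adjoint A = A" "A \<in> carrier_mat N N" "set xs \<subseteq> {..<N}" "set ys \<subseteq> {..<N}"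
  shows "mat_adjoint (sub_mat A xs ys) = sub_mat A ys xs"
proof (rule eq_matI)
  fix i j assume ij: "i < dim_row (sub_mat A ys xs)" "j < dim_col (sub_mat A ys xs)"
  then have "xs ! j < N" "ys ! i < N" using assms(3,4) by (auto simp: subset_iff)
  then have "mat_adjoint A $$ (ys ! i, xs ! j) = cnj (A $$ (xs ! j, ys ! i))" using assms(2) by simp
  with ij assms(1) show "mat_adjoint (sub_mat A xs ys) $$ (i, j) = sub_mat A ys xs $$ (i, j)" by simp
qed auto

definition selection_mat :: "nat \<Rightarrow> nat list \<Rightarrow> complex mat" where
  "selection_mat N xs = mat N (length xs) (\<lambda>(p, a). if p = xs ! a then 1 else 0)"

lemma selection_mat_carrier [simp]: "selection_mat N xs \<in> carrier_mat N (length xs)"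
  by (simp add: selection_mat_def)

text \<open>This form gives access to the congruence lemmas and to multiplicativity of
  \<open>det\<close>.\<close>

lemma sub_mat_eq_congruence:
  assumes A: "A \<in> carrier_mat N N" and xs: "set xs \<subseteq> {..<N}"
  shows "sub_mat A xs xs = mat_adjoint (selection_mat N xs) * A * selection_mat N xs"
    (is "_ = mat_adjoint ?E * A * ?E")
proof (rule eq_matI)
  fix i j assume "i < dim_row (mat_adjoint ?E * A * ?E)" "j < dim_col (mat_adjoint ?E * A * ?E)"
  then have ij: "i < length xs" "j < length xs" by (auto simp: selection_mat_def)
  then have lt: "xs ! i < N" "xs ! j < N" using xs by (auto simp: subset_iff)
  have row: "(mat_adjoint ?E * A) $$ (i, q) = A $$ (xs ! i, q)" if "q < N" for q
  proof -
    have "(mat_adjoint ?E * A) $$ (i, q) = (\<Sum>p<N. mat_adjoint ?E $$ (i, p) * A $$ (p, q))"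
      using ij that A by (intro index_mult_mat_sum[of _ "length xs" N _ N]) auto
    also have "\<dots> = (\<Sum>p<N. if p = xs ! i then A $$ (p, q) else 0)"
      by (rule sum.cong) (use ij in \<open>auto simp: selection_mat_def\<close>)
    finally have "(mat_adjoint ?E * A) $$ (i, q) = (\<Sum>p<N. if p = xs ! i then A $$ (p, q) else 0)" .
    with lt show ?thesis by simp
  qed
  have "(mat_adjoint ?E * A * ?E) $$ (i, j) = (\<Sum>q<N. (mat_adjoint ?E * A) $$ (i, q) * ?E $$ (q, j))"
    using ij A by (intro index_mult_mat_sum[of _ "length xs" N _ "length xs"]) (auto intro: mult_carrier_mat[OF mat_adjoint_carrier[OF selection_mat_carrier]])
  also have "\<dots> = (\<Sum>q<N. if q = xs ! j then A $$ (xs ! i, q) else 0)"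
    by (rule sum.cong) (use row ij in \<open>auto simp: selection_mat_def\<close>)
  finally show "sub_mat A xs xs $$ (i, j) = (mat_adjoint ?E * A * ?E) $$ (i, j)"
    using ij lt by simp
qed (auto simp: selection_mat_def)

text \<open>Distinct indices make the selection matrix injective: entry \<open>xs ! a\<close> of the
  image of \<open>v\<close> is \<open>v $ a\<close>.\<close>

lemma positive_definite_sub_mat:
  assumes A: "positive_definite A" "A \<in> carrier_mat N N" and xs: "distinct xs" "set xs \<subseteq> {..<N}"
  shows "positive_definite (sub_mat A xs xs)"
  unfolding sub_mat_eq_congruence[OF A(2) xs(2)]
proof (rule positive_definite_congruence[OF A selection_mat_carrier])
  fix v assume v: "v \<in> carrier_vec (length xs)" and 0: "selection_mat N xs *\<^sub>v v = 0\<^sub>v N"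
  show "v = 0\<^sub>v (length xs)"
  proof (rule eq_vecI)
    fix a assume "a < dim_vec (0\<^sub>v (length xs) :: complex vec)"
    then have a: "a < length xs" by simp
    then have lt: "xs ! a < N" using xs by (auto simp: subset_iff)
    have "0 = (selection_mat N xs *\<^sub>v v) $ (xs ! a)" using 0 lt by simp
    also have "\<dots> = (\<Sum>b<length xs. selection_mat N xs $$ (xs ! a, b) * v $ b)"
      using lt v by (simp add: scalar_prod_def selection_mat_def atLeast0LessThan)
    also have "\<dots> = (\<Sum>b<length xs. if b = a then v $ b else 0)"
      by (rule sum.cong) (use lt a xs(1) in \<open>auto simp: selection_mat_def nth_eq_iff_index_eq\<close>)
    finally show "v $ a = 0\<^sub>v (length xs) $ a" using a by simp
  qed (use v in auto)
qed

text \<open>The congruence contributes a factor that does not depend on the matrix. The identity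
  matrix, unchanged by a simultaneous permutation of rows and columns, shows that this factor is
  \<open>1\<close>.\<close>

lemma det_sub_mat_permuted:
  assumes A: "A \<in> carrier_mat N N" and xs: "distinct xs" "set xs = {..<N}"
  shows "det (sub_mat A xs xs) = (det A :: complex)"
proof -
  let ?E = "selection_mat N xs"
  have len: "length xs = N" using distinct_card[OF xs(1)] xs(2) by simp
  have E: "?E \<in> carrier_mat N N" using selection_mat_carrier[of N xs] len by simp
  have det_congr: "det (sub_mat B xs xs) = det (mat_adjoint ?E) * det ?E * det B"
    if "B \<in> carrier_mat N N" for B :: "complex mat"
  proof -
    have "mat_adjoint ?E * B \<in> carrier_mat N N" using mult_carrier_mat[OF mat_adjoint_carrier[OF E] that] .
    then show ?thesis
      using sub_mat_eq_congruence[OF that, of xs] xs(2) E that by (simp add: det_mult[of _ N] mult_ac)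
  qed
  have "sub_mat (1\<^sub>m N) xs xs = (1\<^sub>m N :: complex mat)"
  proof (rule eq_matI)
    fix i j assume "i < dim_row (1\<^sub>m N :: complex mat)" "j < dim_col (1\<^sub>m N :: complex mat)"
    then have ij: "i < length xs" "j < length xs" using len by auto
    then have "xs ! i < N" "xs ! j < N" using nth_mem xs(2) by blast+
    with ij xs(1) len show "sub_mat (1\<^sub>m N) xs xs $$ (i, j) = (1\<^sub>m N :: complex mat) $$ (i, j)"
      by (simp add: nth_eq_iff_index_eq)
  qed (auto simp: len)
  with det_congr[of "1\<^sub>m N"] have "det (mat_adjoint ?E) * det ?E = 1" by simp
  with det_congr[OF A] show ?thesis by simp
qed

text \<open>With \<open>Y = S + T\<close> and \<open>det P = det X * det S\<close> from the Schur
  complement, the bounds of \<open>det_add_positive\<close> are multiplied by \<open>det X\<close>.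
  The first two claims are Fischer's inequality and its strict form, the others a sharpening for
  square \<open>C\<close>.\<close>

lemma det_sub_mat_append:
  assumes A: "positive_definite A" "A \<in> carrier_mat N N"
    and xs: "distinct (xs @ ys)" "set (xs @ ys) \<subseteq> {..<N}"
  defines "X \<equiv> sub_mat A xs xs" and "C \<equiv> sub_mat A xs ys" and "Y \<equiv> sub_mat A ys ys"
    and "P \<equiv> sub_mat A (xs @ ys) (xs @ ys)"
  shows "Re (det P) \<le> Re (det X) * Re (det Y)"
    and "C \<noteq> 0\<^sub>m (length xs) (length ys) \<Longrightarrow> Re (det P) < Re (det X) * Re (det Y)"
    and "length xs = length ys \<Longrightarrow> 1 \<le> length ys \<Longrightarrow>
           Re (det P) + (cmod (det C))\<^sup>2 \<le> Re (det X) * Re (det Y)"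
    and "length xs = length ys \<Longrightarrow> 2 \<le> length ys \<Longrightarrow> det C \<noteq> 0 \<Longrightarrow>
           Re (det P) + (cmod (det C))\<^sup>2 < Re (det X) * Re (det Y)"
proof -
  have aC: "sub_mat A ys xs = mat_adjoint C"
    unfolding C_def using mat_adjoint_sub_mat[OF positive_definite_adjoint[OF A(1)] A(2), of xs ys] xs
    by simp
  have P: "P = four_block_mat X C (mat_adjoint C) Y"
    unfolding P_def sub_mat_append aC by (simp add: X_def C_def Y_def)
  have "positive_definite P" unfolding P_def using A xs by (rule positive_definite_sub_mat)
  then have Ppd: "positive_definite (four_block_mat X C (mat_adjoint C) Y)" using P by simp
  have X: "positive_definite X" "X \<in> carrier_mat (length xs) (length xs)"
    using positive_definite_sub_mat[OF A, of xs] xs by (auto simp: X_def)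
  have C: "C \<in> carrier_mat (length xs) (length ys)" by (simp add: C_def)
  have Y: "Y \<in> carrier_mat (length ys) (length ys)" by (simp add: Y_def)
  obtain S T where S: "positive_definite S" "S \<in> carrier_mat (length ys) (length ys)"
    and T: "positive_semidefinite T" "T \<in> carrier_mat (length ys) (length ys)" and Y: "Y = S + T"
    and dP: "det P = det X * det S"
    and C0: "T = 0\<^sub>m (length ys) (length ys) \<Longrightarrow> C = 0\<^sub>m (length xs) (length ys)"
    and dC: "length xs = length ys \<Longrightarrow> Re (det X) * cmod (det T) = (cmod (det C))\<^sup>2"
    using schur_complement[OF X C Y Ppd] P by metis
  have RP: "Re (det P) = Re (det X) * Re (det S)"
    unfolding dP using X by (rule Re_det_mult_positive_definite)
  have pos: "0 < Re (det X)" using det_positive_definite X by blast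
  note add = det_add_positive[OF S T, folded Y]
  show "Re (det P) \<le> Re (det X) * Re (det Y)"
    unfolding RP using add(1) pos by simp
  show "Re (det P) < Re (det X) * Re (det Y)" if "C \<noteq> 0\<^sub>m (length xs) (length ys)"
    unfolding RP using add(2) C0 pos that by auto
  show "Re (det P) + (cmod (det C))\<^sup>2 \<le> Re (det X) * Re (det Y)"
    if "length xs = length ys" "1 \<le> length ys"
    unfolding RP dC[OF that(1), symmetric] using add(3)[OF that(2)] pos
    by (simp flip: distrib_left)
  show "Re (det P) + (cmod (det C))\<^sup>2 < Re (det X) * Re (det Y)"
    if "length xs = length ys" "2 \<le> length ys" "det C \<noteq> 0"
  proof -
    have "det T \<noteq> 0" using dC[OF that(1)] that(3) by auto
    then show ?thesis
      unfolding RP dC[OF that(1), symmetric] using add(4)[OF that(2)] pos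
      by (simp flip: distrib_left)
  qed
qed

subsection \<open>Block determinants\<close>

definition block_indices :: "nat \<Rightarrow> nat list \<Rightarrow> nat list" where
  "block_indices m bs = concat (map (\<lambda>i. [i * m..<i * m + m]) bs)"

lemma block_indices_simps [simp]:
  "block_indices m [] = []"
  "block_indices m (bs @ cs) = block_indices m bs @ block_indices m cs"
  by (simp_all add: block_indices_def)

lemma length_block_indices_single [simp]: "length (block_indices m [i]) = m"
  by (simp add: block_indices_def)

lemma block_eq_sub_mat: "block m A i j = sub_mat A (block_indices m [i]) (block_indices m [j])"
  by (rule eq_matI) (auto simp: block_def block_indices_def)

lemma set_block_indices:
  assumes "0 < m"
  shows "set (block_indices m bs) = {x. x div m \<in> set bs}"
proof -
  have "x \<in> {i * m..<i * m + m} \<longleftrightarrow> x div m = i" for x i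
    using assms by (auto intro: div_nat_eqI simp: mult.commute dividend_less_times_div)
      (metis add.commute dividend_less_times_div)
  then show ?thesis by (auto simp: block_indices_def)
qed

lemma distinct_block_indices:
  assumes "0 < m" "distinct bs"
  shows "distinct (block_indices m bs)"
  using assms(2)
proof (induction bs rule: rev_induct)
  case (snoc b bs)
  have "distinct (block_indices m [b])" by (simp add: block_indices_def)
  with snoc show ?case using assms(1) by (auto simp: set_block_indices)
qed simp

lemma set_block_indices_subset:
  assumes "0 < m" "set bs \<subseteq> {..<n}"
  shows "set (block_indices m bs) \<subseteq> {..<n * m}"
  using assms by (auto simp: set_block_indices subset_iff div_less_iff_less_mult)

lemma block_indices_all: "0 < m \<Longrightarrow> set bs = {..<n} \<Longrightarrow> set (block_indices m bs) = {..<n * m}"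
  by (auto simp: set_block_indices div_less_iff_less_mult)

lemma det_diagonal_block:
  assumes A: "positive_definite A" "A \<in> carrier_mat (n * m) (n * m)" and "0 < m" "i < n"
  shows "0 < Re (det (block m A i i))"
    and "det (block m A i i) = complex_of_real (Re (det (block m A i i)))"
proof -
  have "positive_definite (block m A i i)"
    unfolding block_eq_sub_mat using assms
    by (intro positive_definite_sub_mat[OF A] distinct_block_indices set_block_indices_subset) auto
  from det_positive_definite[OF this, of m]
  show "0 < Re (det (block m A i i))"
    and "det (block m A i i) = complex_of_real (Re (det (block m A i i)))"
    by (simp_all add: block_def)
qed

text \<open>Blocks of \<open>bs\<close> are split off one at a time from the right, while those of
  \<open>as\<close> stay together; a pair \<open>[i, j]\<close> can thus be kept apart from the
  rest.\<close>

lemma fischer_block_indices: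
  assumes A: "positive_definite A" "A \<in> carrier_mat (n * m) (n * m)" and m: "0 < m"
  shows "distinct (as @ bs) \<Longrightarrow> set (as @ bs) \<subseteq> {..<n} \<Longrightarrow>
    Re (det (sub_mat A (block_indices m (as @ bs)) (block_indices m (as @ bs))))
      \<le> Re (det (sub_mat A (block_indices m as) (block_indices m as)))
          * (\<Prod>b\<leftarrow>bs. Re (det (block m A b b)))"
proof (induction bs rule: rev_induct)
  case (snoc b bs)
  let ?d = "\<lambda>cs. Re (det (sub_mat A (block_indices m cs) (block_indices m cs)))"
  let ?xs = "block_indices m (as @ bs)" and ?ys = "block_indices m [b]"
  have "distinct (block_indices m ((as @ bs) @ [b]))" "set (block_indices m ((as @ bs) @ [b])) \<subseteq> {..<n * m}"
    using m snoc.prems by (intro distinct_block_indices set_block_indices_subset; simp)+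
  then have "distinct (?xs @ ?ys)" "set (?xs @ ?ys) \<subseteq> {..<n * m}"
    by (simp_all only: block_indices_simps)
  from det_sub_mat_append(1)[OF A this]
  have "?d ((as @ bs) @ [b]) \<le> ?d (as @ bs) * Re (det (block m A b b))"
    by (simp only: block_indices_simps block_eq_sub_mat)
  also have "\<dots> \<le> (?d as * (\<Prod>b\<leftarrow>bs. Re (det (block m A b b)))) * Re (det (block m A b b))"
    using snoc det_diagonal_block(1)[OF A m, of b] by (intro mult_right_mono snoc.IH) auto
  finally show ?case by (simp add: mult.assoc)
qed simp

text \<open>Reordering puts blocks \<open>i\<close> and \<open>j\<close> first, Fischer's inequality
  splits off the others, and \<open>det_sub_mat_append\<close> bounds the remaining pair. The factor
  \<open>1 - q\<close> is the pair bound relative to \<open>d i * d j\<close>.\<close>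

lemma det_block_pair:
  assumes A: "positive_definite A" "A \<in> carrier_mat (n * m) (n * m)" and m: "0 < m"
    and ij: "i < n" "j < n" "i \<noteq> j"
  defines "d \<equiv> \<lambda>k. Re (det (block m A k k))"
  defines "q \<equiv> (cmod (det (block m A i j)))\<^sup>2 / (d i * d j)"
  shows "Re (det A) \<le> (\<Prod>k<n. d k) * (1 - q)"
    and "block m A i j \<noteq> 0\<^sub>m m m \<Longrightarrow> Re (det A) < (\<Prod>k<n. d k)"
    and "2 \<le> m \<Longrightarrow> q \<noteq> 0 \<Longrightarrow> Re (det A) < (\<Prod>k<n. d k) * (1 - q)"
proof -
  let ?c = "(cmod (det (block m A i j)))\<^sup>2"
  define rest where "rest = filter (\<lambda>k. k \<noteq> i \<and> k \<noteq> j) [0..<n]"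
  define r where "r = (\<Prod>k\<leftarrow>rest. d k)"
  define P where "P = Re (det (sub_mat A (block_indices m [i, j]) (block_indices m [i, j])))"
  have dpos: "0 < d k" if "k < n" for k
    unfolding d_def using det_diagonal_block(1)[OF A m that] .
  have r: "r = (\<Prod>k\<in>{..<n} - {i, j}. d k)"
  proof -
    have "set rest = {..<n} - {i, j}" "distinct rest" by (auto simp: rest_def)
    then show ?thesis unfolding r_def by (metis prod.distinct_set_conv_list)
  qed
  have rpos: "0 < r" unfolding r using dpos by (intro prod_pos) auto
  have D: "(\<Prod>k<n. d k) = d i * d j * r"
  proof -
    have "(\<Prod>k<n. d k) = d i * (\<Prod>k\<in>{..<n} - {i}. d k)" using ij by (intro prod.remove) auto
    also have "(\<Prod>k\<in>{..<n} - {i}. d k) = d j * (\<Prod>k\<in>{..<n} - {i} - {j}. d k)"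
      using ij by (intro prod.remove) auto
    also have "{..<n} - {i} - {j} = {..<n} - {i, j}" by auto
    finally show ?thesis unfolding r by simp
  qed
  have Dq: "(\<Prod>k<n. d k) * (1 - q) = (d i * d j - ?c) * r"
    unfolding D q_def using dpos[OF ij(1)] dpos[OF ij(2)] by (simp add: field_simps)
  have idx: "distinct ([i, j] @ rest)" "set ([i, j] @ rest) = {..<n}"
    using ij by (auto simp: rest_def)
  have "det A = det (sub_mat A (block_indices m ([i, j] @ rest)) (block_indices m ([i, j] @ rest)))"
    using det_sub_mat_permuted[OF A(2)] distinct_block_indices[OF m idx(1)] block_indices_all[OF m idx(2)]
    by simp
  then have detA: "Re (det A) \<le> P * r"
    using fischer_block_indices[OF A m idx(1) equalityD1[OF idx(2)]] by (simp add: P_def r_def d_def)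
  have "distinct (block_indices m ([i] @ [j]))" "set (block_indices m ([i] @ [j])) \<subseteq> {..<n * m}"
    using m ij by (intro distinct_block_indices set_block_indices_subset; simp)+
  then have pair: "distinct (block_indices m [i] @ block_indices m [j])"
    "set (block_indices m [i] @ block_indices m [j]) \<subseteq> {..<n * m}"
    by (simp_all only: block_indices_simps)
  have P: "P = Re (det (sub_mat A (block_indices m [i] @ block_indices m [j])
      (block_indices m [i] @ block_indices m [j])))"
    by (simp add: P_def flip: block_indices_simps(2))
  note app = det_sub_mat_append[OF A pair, folded block_eq_sub_mat P d_def,
      unfolded length_block_indices_single]
  have "P \<le> d i * d j - ?c" using app(3) m by (simp add: d_def)
  then show "Re (det A) \<le> (\<Prod>k<n. d k) * (1 - q)"
    unfolding Dq using detA rpos by (meson less_imp_le mult_right_mono order_trans)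
  show "Re (det A) < (\<Prod>k<n. d k)" if "block m A i j \<noteq> 0\<^sub>m m m"
  proof -
    have "P < d i * d j" using app(2) that by (simp add: d_def)
    then show ?thesis unfolding D using detA rpos by (meson mult_strict_right_mono order_le_less_trans)
  qed
  show "Re (det A) < (\<Prod>k<n. d k) * (1 - q)" if "2 \<le> m" "q \<noteq> 0"
  proof -
    have "P < d i * d j - ?c" using app(4) that by (auto simp: d_def q_def)
    then show ?thesis unfolding Dq using detA rpos by (meson mult_strict_right_mono order_le_less_trans)
  qed
qed

text \<open>Splitting off the last block leaves a four-block matrix with zero upper right part, so
  the determinant factors.\<close>

lemma det_block_diagonal:
  fixes A :: "'a :: idom mat"
  assumes A: "A \<in> carrier_mat (n * m) (n * m)" and m: "0 < m" and bd: "block_diagonal n m A"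
  shows "det A = (\<Prod>i<n. det (block m A i i))"
proof -
  \<comment> \<open>Entry \<open>(x, y)\<close> lies in block \<open>(x div m, y div m)\<close> at
    position \<open>(x mod m, y mod m)\<close>.\<close>
  have zero: "A $$ (x, y) = 0" if "x < n * m" "y < n * m" "x div m \<noteq> y div m" for x y
  proof -
    have "block m A (x div m) (y div m) = 0\<^sub>m m m"
      using bd that by (auto simp: block_diagonal_def less_mult_imp_div_less)
    then have "block m A (x div m) (y div m) $$ (x mod m, y mod m) = 0" using m by simp
    then show ?thesis using m by (simp add: block_def)
  qed
  \<comment> \<open>The claim is generalised to lists of blocks for the induction; the list
    \<open>[0..<n]\<close> recovers \<open>A\<close>.\<close>
  have "distinct bs \<Longrightarrow> set bs \<subseteq> {..<n} \<Longrightarrow>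
    det (sub_mat A (block_indices m bs) (block_indices m bs)) = (\<Prod>b\<leftarrow>bs. det (block m A b b))" for bs
  proof (induction bs rule: rev_induct)
    case Nil
    then show ?case by (simp add: det_dim_zero sub_mat_def)
  next
    case (snoc b bs)
    let ?xs = "block_indices m bs" and ?ys = "block_indices m [b]"
    have "sub_mat A ?xs ?ys = 0\<^sub>m (length ?xs) (length ?ys)"
    proof (rule eq_matI)
      fix p q assume "p < dim_row (0\<^sub>m (length ?xs) (length ?ys) :: 'a mat)"
        and "q < dim_col (0\<^sub>m (length ?xs) (length ?ys) :: 'a mat)"
      then have pq: "p < length ?xs" "q < length ?ys" by auto
      then have "?xs ! p \<in> set ?xs" "?ys ! q \<in> set ?ys" using nth_mem by blast+
      moreover have "set ?xs \<subseteq> {..<n * m}" "set ?ys \<subseteq> {..<n * m}"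
        using snoc.prems m by (intro set_block_indices_subset; simp)+
      moreover have "(?xs ! p) div m \<in> set bs" "(?ys ! q) div m = b"
        using calculation(1,2) m by (auto simp: set_block_indices)
      ultimately have "A $$ (?xs ! p, ?ys ! q) = 0" using zero snoc.prems by (metis distinct_append
          disjoint_iff lessThan_iff list.set_intros(1) subsetD)
      with pq show "sub_mat A ?xs ?ys $$ (p, q) = 0\<^sub>m (length ?xs) (length ?ys) $$ (p, q)" by simp
    qed auto
    then have "det (sub_mat A (?xs @ ?ys) (?xs @ ?ys)) = det (sub_mat A ?xs ?xs) * det (sub_mat A ?ys ?ys)"
      unfolding sub_mat_append by (intro det_four_block_mat_upper_right_zero) auto
    with snoc show ?case by (simp add: block_eq_sub_mat)
  qed
  from this[of "[0..<n]"]
  have "det (sub_mat A (block_indices m [0..<n]) (block_indices m [0..<n])) = (\<Prod>i<n. det (block m A i i))"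
    by (simp add: atLeast0LessThan prod.distinct_set_conv_list[symmetric] subset_iff)
  moreover have "sub_mat A (block_indices m [0..<n]) (block_indices m [0..<n]) = A"
  proof -
    have "block_indices m [0..<n] = [0..<n * m]"
    proof (induction n)
      case (Suc n)
      have "[0..<n * m + m] = [0..<n * m] @ [n * m..<n * m + m]" by (rule upt_add_eq_append) simp
      with Suc show ?case by (simp add: block_indices_def add.commute)
    qed (simp add: block_indices_def)
    then show ?thesis using A by (intro eq_matI) auto
  qed
  ultimately show ?thesis by simp
qed

text \<open>Since \<open>\<tau>\<close> permutes the indices, each \<open>d i\<close> occurs twice
  in the denominators, so the squared product of the \<open>p i\<close> is the squared product of
  the \<open>d i\<close> times the product of the \<open>q i\<close>. A maximal \<open>q k\<close>
  bounds the latter by \<open>q k ^ n\<close>; comparing squares avoids half-integer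
  exponents.\<close>

lemma prod_permuted_ratio_bound:
  fixes p d :: "nat \<Rightarrow> real"
  assumes n: "2 \<le> n" and \<tau>: "\<tau> permutes {..<n}"
    and p: "\<And>i. i < n \<Longrightarrow> 0 \<le> p i" and d: "\<And>i. i < n \<Longrightarrow> 0 < d i"
  defines "q \<equiv> \<lambda>i. (p i)\<^sup>2 / (d i * d (\<tau> i))"
  assumes q: "\<And>i. i < n \<Longrightarrow> q i < 1"
  obtains k where "k < n" "(\<Prod>i<n. p i) \<le> (\<Prod>i<n. d i) * q k"
    and "3 \<le> n \<Longrightarrow> q k \<noteq> 0 \<Longrightarrow> (\<Prod>i<n. p i) < (\<Prod>i<n. d i) * q k"
proof -
  define D where "D = (\<Prod>i<n. d i)"
  have D: "0 < D" unfolding D_def using d by (intro prod_pos) auto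
  have ti: "\<tau> i < n" if "i < n" for i using permutes_in_image[OF \<tau>, of i] that by simp
  have q0: "0 \<le> q i" if "i < n" for i unfolding q_def using d[OF that] d[OF ti[OF that]] by simp
  have "D = (\<Prod>i<n. d (\<tau> i))" unfolding D_def using prod.permute[OF \<tau>, of d] by (simp add: o_def)
  then have "(\<Prod>i<n. q i) = (\<Prod>i<n. p i)\<^sup>2 / D\<^sup>2"
    by (simp add: q_def prod_dividef prod.distrib prod_power_distrib D_def power2_eq_square)
  then have sq: "(\<Prod>i<n. p i)\<^sup>2 = D\<^sup>2 * (\<Prod>i<n. q i)" using D by simp
  have "finite (q ` {..<n})" "q ` {..<n} \<noteq> {}" using n by (auto simp: lessThan_empty_iff)
  then have "Max (q ` {..<n}) \<in> q ` {..<n}" by (rule Max_in)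
  then obtain k where k: "k < n" "q k = Max (q ` {..<n})" by (metis imageE lessThan_iff)
  then have max: "q i \<le> q k" if "i < n" for i using that by simp
  have "(\<Prod>i<n. q i) \<le> (\<Prod>i<n. q k)" using max q0 by (intro prod_mono) auto
  then have le: "(\<Prod>i<n. p i)\<^sup>2 \<le> D\<^sup>2 * q k ^ n" unfolding sq using D by simp
  have Dq: "0 \<le> D * q k" using D q0[OF k(1)] by simp
  show thesis
  proof (rule that[OF k(1)])
    \<comment> \<open>As \<open>0 \<le> q k < 1\<close>, lowering the exponent from \<open>n\<close>
      to \<open>2\<close> can only enlarge the power; for \<open>n \<ge> 3\<close> and nonzero
      \<open>q k\<close> it does so strictly.\<close>
    have "q k ^ n \<le> (q k)\<^sup>2" using q0[OF k(1)] q[OF k(1)] n by (intro power_decreasing) auto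
    then have "D\<^sup>2 * q k ^ n \<le> (D * q k)\<^sup>2" using D by (simp add: power_mult_distrib)
    with le have "(\<Prod>i<n. p i)\<^sup>2 \<le> (D * q k)\<^sup>2" by (rule order_trans)
    then show "(\<Prod>i<n. p i) \<le> (\<Prod>i<n. d i) * q k"
      unfolding D_def[symmetric] using Dq by (rule power2_le_imp_le)
  next
    assume "3 \<le> n" "q k \<noteq> 0"
    then have "q k ^ n < (q k)\<^sup>2" using q0[OF k(1)] q[OF k(1)] by (intro power_strict_decreasing) auto
    then have "D\<^sup>2 * q k ^ n < (D * q k)\<^sup>2" using D by (simp add: power_mult_distrib)
    with le have "(\<Prod>i<n. p i)\<^sup>2 < (D * q k)\<^sup>2" by (rule order_le_less_trans)
    then show "(\<Prod>i<n. p i) < (\<Prod>i<n. d i) * q k"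
      unfolding D_def[symmetric] using Dq by (rule power2_less_imp_less)
  qed
qed

text \<open>The equality claim leaves out \<open>n = 2\<close>, \<open>m = 1\<close>, where
  \<open>det A\<close> plus the squared modulus of the off-diagonal entry always equals the product
  of the diagonal entries. For \<open>n = 0\<close> or \<open>m = 0\<close> all determinants and
  products are \<open>1\<close>, and the inequality would read \<open>2 \<le> 1\<close>.\<close>

theorem theorem2p13:
  fixes n m :: nat and A :: "complex mat" and \<tau> :: "nat \<Rightarrow> nat"
  assumes "n \<ge> 1" and "m \<ge> 1"
    and "A \<in> carrier_mat (n * m) (n * m)"
    and "positive_definite A"
    and "\<tau> \<in> derangements n"
  shows "det A + complex_of_real (\<Prod>i<n. cmod (det (block m A i (\<tau> i))))
           \<le> (\<Prod>i<n. det (block m A i i))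
         \<and> (\<not> (n = 2 \<and> m = 1) \<longrightarrow>
              (det A + complex_of_real (\<Prod>i<n. cmod (det (block m A i (\<tau> i))))
                 = (\<Prod>i<n. det (block m A i i))
               \<longleftrightarrow> block_diagonal n m A))"
proof -
  define p where "p i = cmod (det (block m A i (\<tau> i)))" for i
  define d where "d i = Re (det (block m A i i))" for i
  define q where "q i = (p i)\<^sup>2 / (d i * d (\<tau> i))" for i
  define D where "D = (\<Prod>i<n. d i)"
  have m: "0 < m" using assms(2) by simp
  have \<tau>: "\<tau> permutes {..<n}" and fixfree: "\<And>i. i < n \<Longrightarrow> \<tau> i \<noteq> i"
    using assms(5) by (auto simp: derangements_def)
  have ti: "\<tau> i < n" if "i < n" for i using permutes_in_image[OF \<tau>, of i] that by simp
  \<comment> \<open>\<open>\<tau> 0\<close> is a second index below \<open>n\<close>, as a single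
    index has no derangement.\<close>
  have n: "2 \<le> n" using ti[of 0] fixfree[of 0] assms(1) by simp
  have dpos: "0 < d i" and dblock: "det (block m A i i) = complex_of_real (d i)" if "i < n" for i
    unfolding d_def using det_diagonal_block[OF assms(4,3) m that] by auto
  have D: "0 < D" unfolding D_def using dpos by (intro prod_pos) auto
  have DD: "(\<Prod>i<n. det (block m A i i)) = complex_of_real D" by (simp add: D_def dblock)
  have detA: "0 < Re (det A)" "det A = complex_of_real (Re (det A))"
    using det_positive_definite[OF assms(4,3)] .
  note pair = det_block_pair[OF assms(4,3) m, folded d_def, folded D_def]
  have pairq: "Re (det A) \<le> D * (1 - q i)" "2 \<le> m \<Longrightarrow> q i \<noteq> 0 \<Longrightarrow> Re (det A) < D * (1 - q i)"
    if "i < n" for i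
    using pair(1,3)[OF that ti[OF that]] fixfree[OF that] by (auto simp: q_def p_def)
  \<comment> \<open>Positivity of \<open>det A\<close> in the pair bound forces the ratios below
    \<open>1\<close>, as \<open>prod_permuted_ratio_bound\<close> requires.\<close>
  have "q i < 1" if "i < n" for i
  proof -
    have "0 < D * (1 - q i)" using pairq(1)[OF that] detA(1) by linarith
    with D show ?thesis by (simp add: zero_less_mult_iff)
  qed
  then obtain k where k: "k < n" "(\<Prod>i<n. p i) \<le> D * q k"
    and strict: "3 \<le> n \<Longrightarrow> q k \<noteq> 0 \<Longrightarrow> (\<Prod>i<n. p i) < D * q k"
    using prod_permuted_ratio_bound[OF n \<tau>, of p d] dpos
    unfolding D_def q_def by (metis norm_ge_zero p_def)
  \<comment> \<open>The bounds \<open>D * (1 - q k)\<close> and \<open>D * q k\<close> add up to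
    \<open>D\<close>.\<close>
  have le: "Re (det A) + (\<Prod>i<n. p i) \<le> D"
    using pairq(1)[OF k(1)] k(2) by (simp add: right_diff_distrib)
  have diag: "block_diagonal n m A" if eq: "Re (det A) + (\<Prod>i<n. p i) = D" and nm: "\<not> (n = 2 \<and> m = 1)"
  proof -
    have "q k = 0"
    proof (rule ccontr)
      assume q: "q k \<noteq> 0"
      \<comment> \<open>For \<open>n \<ge> 3\<close> the bound on the product is strict, for
        \<open>m \<ge> 2\<close> the bound on \<open>det A\<close>; only \<open>n = 2\<close>,
        \<open>m = 1\<close> escapes both.\<close>
      consider "3 \<le> n" | "2 \<le> m" using n m nm by linarith
      then have "Re (det A) + (\<Prod>i<n. p i) < D * (1 - q k) + D * q k"
      proof cases
        case 1
        then show ?thesis using strict q pairq(1)[OF k(1)] by simp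
      next
        case 2
        then show ?thesis using k(2) q pairq(2)[OF k(1)] by simp
      qed
      with eq show False by (simp add: algebra_simps)
    qed
    moreover have "0 \<le> (\<Prod>i<n. p i)" by (intro prod_nonneg) (simp add: p_def)
    ultimately have "Re (det A) = D" using eq k(2) by simp
    \<comment> \<open>A nonzero off-diagonal block would make \<open>det A\<close> smaller than
      \<open>D\<close> by the strict Fischer bound.\<close>
    then show ?thesis using pair(2) unfolding block_diagonal_def by (metis less_irrefl)
  qed
  have "det A + complex_of_real (\<Prod>i<n. p i) = complex_of_real D" if bd: "block_diagonal n m A"
  proof -
    \<comment> \<open>This block lies off the diagonal; as \<open>m > 0\<close>, its determinant is
      a zero factor of the product along \<open>\<tau>\<close>.\<close>
    have "block m A 0 (\<tau> 0) = 0\<^sub>m m m"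
      using bd ti[of 0] fixfree[of 0] assms(1) by (auto simp: block_diagonal_def)
    then have "p 0 = 0" using m by (simp add: p_def)
    then have "(\<Prod>i<n. p i) = 0" using assms(1) by (intro prod_zero) auto
    then show ?thesis using det_block_diagonal[OF assms(3) m bd] DD by simp
  qed
  \<comment> \<open>Both sides are real, so complex order and equality reduce to real parts.\<close>
  moreover have "det A + complex_of_real (\<Prod>i<n. p i) = complex_of_real (Re (det A) + (\<Prod>i<n. p i))"
    using detA(2) by simp
  ultimately show ?thesis
    using le diag unfolding DD p_def[symmetric] of_real_eq_iff
    by (auto simp: less_eq_complex_def complex_eq_iff simp del: of_real_prod)
qed

end
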